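(* Let $\delta>0$, let $\xi_1,\dots,\xi_N$ be real numbers such that $\delta\le|\xi_m-\xi_n|$ whenever $m\ne n$, and let $a_1,\dots,a_N$ be complex numbers. If $0<\sigma<1$ then $$-\frac{(2-2^{2-\sigma})\zeta(\sigma)}{\delta^\sigma}\sum_{n=1}^N|a_n|^2\le\sum_{m=1}^N\sum_{\substack{n=1\\ n\ne m}}^N\frac{a_m\overline{a}_n}{|\xi_m-\xi_n|^\sigma};$$ if $\sigma=1$ then $$-\frac{\log4}{\delta}\sum_{n=1}^N|a_n|^2\le\sum_{m=1}^N\sum_{\substack{n=1\\ n\ne m}}^N\frac{a_m\overline{a}_n}{|\xi_m-\xi_n|};$$ and if $1<\sigma$ then $$-\frac{(2-2^{2-\sigma})\zeta(\sigma)}{\delta^\sigma}\sum_{n=1}^N|a_n|^2\le\sum_{m=1}^N\sum_{\substack{n=1\\ n\ne m}}^N\frac{a_m\overline{a}_n}{|\xi_m-\xi_n|^\sigma}\le\frac{2\zeta(\sigma)}{\delta^\sigma}\sum_{n=1}^N|a_n|^2.$$ The constants appearing in these inequalities are the best possible (i.e. for given $\sigma$ and $\delta$, none of the constants multiplying $\sum|a_n|^2$ can be replaced by a sharper one valid for all $N$, all such $\xi_1,\dots,\xi_N$ and all $a_1,\dots,a_N$).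
   Context: $\zeta$ is the Riemann zeta-function (analytically continued), $N$ is a positive integer. The double sums are real since the forms are Hermitian. *)

theory Defs
  imports "HOL-Complex_Analysis.Complex_Analysis"
begin

text \<open>
  The Riemann zeta function: the value at \<open>s \<noteq> 1\<close> is that of the unique holomorphic extension of
  the Dirichlet series from \<open>Re z > 1\<close> to any half-plane containing \<open>s\<close>, punctured at \<open>1\<close>.
  Uniqueness, and independence of the half-plane, is lemma \<open>zeta_eqI\<close> below. The value at the
  pole \<open>1\<close> is meaningless.
\<close>

definition zeta_continuation :: "real \<Rightarrow> (complex \<Rightarrow> complex) \<Rightarrow> bool" where
  "zeta_continuation c f \<longleftrightarrow>
     f holomorphic_on ({z. Re z > c} - {1}) \<and>
     (\<forall>z. Re z > 1 \<longrightarrow> (\<lambda>n. 1 / of_nat (Suc n) powr z) sums f z)"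

definition zeta :: "complex \<Rightarrow> complex" where
  "zeta s = (THE w. \<exists>c f. c < Re s \<and> zeta_continuation c f \<and> f s = w)"

lemma zeta_continuation_unique:
  assumes f: "zeta_continuation c f" and g: "zeta_continuation d g"
    and s: "c < Re s" "d < Re s" "s \<noteq> 1"
  shows "f s = g s"
proof -
  define m where "m = max c d"
  have hp: "connected ({z. Re z > m} - {1})"
    by (intro connected_open_diff_countable)
       (auto simp: open_halfspace_Re_gt convex_connected convex_halfspace_Re_gt
             intro!: exI[of _ "complex_of_real (m + 1)"] exI[of _ "complex_of_real (m + 2)"])
  show ?thesis
  proof (rule analytic_continuation_open[of "{z. Re z > max m 1}" "{z. Re z > m} - {1}" f g])
    show "{z. Re z > max m 1} \<noteq> {}"
      by (metis (mono_tags) Re_complex_of_real empty_iff gt_ex mem_Collect_eq)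
    show "f holomorphic_on ({z. Re z > m} - {1})" "g holomorphic_on ({z. Re z > m} - {1})"
      using f g unfolding zeta_continuation_def m_def
      by (auto elim!: holomorphic_on_subset)
    show "f z = g z" if "z \<in> {z. Re z > max m 1}" for z
      using f g that unfolding zeta_continuation_def by (auto dest: sums_unique2)
    show "open {z. Re z > max m 1}" "open ({z. Re z > m} - {1})"
      by (auto intro!: open_Diff simp only: open_halfspace_Re_gt closed_singleton)
  qed (use s hp in \<open>auto simp: m_def\<close>)
qed

lemma zeta_eqI:
  assumes "zeta_continuation c f" "c < Re s" "s \<noteq> 1"
  shows "zeta s = f s"
  unfolding zeta_def using assms zeta_continuation_unique by (intro the_equality) blast+

definition separated :: "real \<Rightarrow> nat \<Rightarrow> (nat \<Rightarrow> real) \<Rightarrow> bool" where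
  "separated \<delta> N \<xi> \<longleftrightarrow> (\<forall>m\<in>{1..N}. \<forall>n\<in>{1..N}. m \<noteq> n \<longrightarrow> \<delta> \<le> \<bar>\<xi> m - \<xi> n\<bar>)"

definition hermitian_form :: "real \<Rightarrow> nat \<Rightarrow> (nat \<Rightarrow> real) \<Rightarrow> (nat \<Rightarrow> complex) \<Rightarrow> complex" where
  "hermitian_form \<sigma> N \<xi> a =
     (\<Sum>m\<in>{1..N}. \<Sum>n\<in>{1..N} - {m}. a m * cnj (a n) / of_real (\<bar>\<xi> m - \<xi> n\<bar> powr \<sigma>))"

text \<open>The form is real, so taking its real part in the inequalities below loses nothing.\<close>

lemma hermitian_form_real: "hermitian_form \<sigma> N \<xi> a \<in> \<real>"
proof -
  let ?t = "\<lambda>m n. if n \<noteq> m then a m * cnj (a n) / of_real (\<bar>\<xi> m - \<xi> n\<bar> powr \<sigma>) else 0"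
  have form: "hermitian_form \<sigma> N \<xi> a = (\<Sum>m\<in>{1..N}. \<Sum>n\<in>{1..N}. ?t m n)"
    unfolding hermitian_form_def by (intro sum.cong sum.mono_neutral_cong_left) auto
  have "cnj (hermitian_form \<sigma> N \<xi> a) = (\<Sum>m\<in>{1..N}. \<Sum>n\<in>{1..N}. ?t n m)"
    unfolding form cnj_sum by (intro sum.cong) (auto simp: abs_minus_commute mult.commute)
  also have "\<dots> = hermitian_form \<sigma> N \<xi> a"
    unfolding form by (rule sum.swap)
  finally show ?thesis
    by (simp add: Reals_cnj_iff)
qed

definition lower_constant :: "real \<Rightarrow> real \<Rightarrow> real \<Rightarrow> bool" where
  "lower_constant \<sigma> \<delta> C \<longleftrightarrow>
     (\<forall>N \<xi> a. N \<ge> 1 \<longrightarrow> separated \<delta> N \<xi> \<longrightarrow>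
        - C * (\<Sum>n\<in>{1..N}. (cmod (a n))\<^sup>2) \<le> Re (hermitian_form \<sigma> N \<xi> a))"

definition upper_constant :: "real \<Rightarrow> real \<Rightarrow> real \<Rightarrow> bool" where
  "upper_constant \<sigma> \<delta> C \<longleftrightarrow>
     (\<forall>N \<xi> a. N \<ge> 1 \<longrightarrow> separated \<delta> N \<xi> \<longrightarrow>
        Re (hermitian_form \<sigma> N \<xi> a) \<le> C * (\<Sum>n\<in>{1..N}. (cmod (a n))\<^sup>2))"

definition best_lower_constant :: "real \<Rightarrow> real \<Rightarrow> real \<Rightarrow> bool" where
  "best_lower_constant \<sigma> \<delta> C \<longleftrightarrow>
     lower_constant \<sigma> \<delta> C \<and> (\<forall>C'<C. \<not> lower_constant \<sigma> \<delta> C')"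

definition best_upper_constant :: "real \<Rightarrow> real \<Rightarrow> real \<Rightarrow> bool" where
  "best_upper_constant \<sigma> \<delta> C \<longleftrightarrow>
     upper_constant \<sigma> \<delta> C \<and> (\<forall>C'<C. \<not> upper_constant \<sigma> \<delta> C')"

end

theory Submission
  imports Defs "HOL-Real_Asymp.Real_Asymp"
begin

text \<open>
  The matrix of the form has the entries \<open>|\<xi> m - \<xi> n| powr - \<sigma>\<close> off the diagonal and zeros on it.
  A lower bound with constant \<open>C\<close> follows from a positive definite function that agrees with
  \<open>|x| powr - \<sigma>\<close> for \<open>|x| \<ge> \<delta>\<close> and takes the value \<open>C\<close> at \<open>0\<close>, since the values for
  \<open>0 < |x| < \<delta>\<close> never occur. Such a function is built from exponentials. The function
  \<open>E x = exp (-l |x|)\<close> is positive definite (\<open>exp_abs_kernel_nonneg\<close>), hence so is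
  \<open>2 E(x) + E(x + \<delta>) + E(x - \<delta>)\<close>. For \<open>|x| \<ge> \<delta>\<close> this is \<open>E x\<close> times
  \<open>2 + exp (l \<delta>) + exp (- l \<delta>)\<close>; after division by this factor its value at \<open>0\<close> is
  \<open>2 / (exp (l \<delta>) + 1)\<close>, which is the alternating sum of the numbers
  \<open>2 exp (- l \<delta> k)\<close> over \<open>k \<ge> 1\<close>. This gives \<open>exponential_form_lower_bound\<close>.

  Integration against \<open>l powr (\<sigma> - 1)\<close> over \<open>l > 0\<close> turns each \<open>exp (- l x)\<close> into
  \<open>Gamma \<sigma> * x powr - \<sigma>\<close>. So the constant for the form is \<open>2 L / \<delta> powr \<sigma>\<close> with
  \<open>L = 1 - 2 powr - \<sigma> + 3 powr - \<sigma> - \<dots>\<close> (\<open>lower_constant_alternating_series\<close>), for every \<open>\<sigma> > 0\<close>.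
  It remains to sum the series: \<open>L = ln 2\<close> for \<open>\<sigma> = 1\<close>, and otherwise
  \<open>L = (1 - 2 powr (1 - \<sigma>)) * zeta \<sigma>\<close> (\<open>alternating_powr_sums_zeta\<close>). For the latter, also with
  \<open>\<sigma> < 1\<close>, the continuation of the zeta function to \<open>Re z > 0\<close> is realised as the limit of
  \<open>1 + 2 powr - z + \<dots> + N powr - z - (N + 1) powr (1 - z) / (1 - z)\<close>.

  The upper bound for \<open>\<sigma> > 1\<close> is Schur's test, with row sums at most twice the zeta series. Both bounds
  are attained in the limit \<open>N \<rightarrow> \<infinity>\<close> for \<open>\<xi> n = n \<delta>\<close>, with \<open>a n = (-1) ^ n\<close> for the lower and
  \<open>a n = 1\<close> for the upper one: then the form per point is a Cesaro mean of the partial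
  sums of the two series (\<open>hermitian_form_progression\<close>).
\<close>

section \<open>Forms with exponential kernels\<close>

text \<open>
  On the half-line \<open>min s t\<close> is the covariance of Brownian motion. Positivity is proved by peeling
  off the smallest value \<open>u k\<close>: it contributes \<open>u k\<close> times a square, and once it is subtracted from
  all the \<open>u i\<close>, the row and the column of \<open>k\<close> vanish, which leaves fewer points.
\<close>

lemma min_kernel_nonneg:
  fixes u :: "'i \<Rightarrow> real" and b :: "'i \<Rightarrow> 'v::real_inner"
  assumes "finite A" "\<And>i. i \<in> A \<Longrightarrow> 0 \<le> u i"
  shows "0 \<le> (\<Sum>i\<in>A. \<Sum>j\<in>A. min (u i) (u j) * (b i \<bullet> b j))"
  using assms
proof (induction A arbitrary: u rule: finite_psubset_induct)
  case (psubset A)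
  show ?case
  proof (cases "A = {}")
    case False
    then obtain k where k: "k \<in> A" "\<And>i. i \<in> A \<Longrightarrow> u k \<le> u i"
      using psubset.hyps by (metis arg_min_if_finite(1) arg_min_least)
    define v where "v i = u i - u k" for i
    have v0: "min (v i) (v j) = 0" if "i \<in> A" "j \<in> A" "i = k \<or> j = k" for i j
      using that k unfolding v_def by fastforce
    have "(\<Sum>i\<in>A. \<Sum>j\<in>A. min (u i) (u j) * (b i \<bullet> b j)) =
          (\<Sum>i\<in>A. \<Sum>j\<in>A. u k * (b i \<bullet> b j) + min (v i) (v j) * (b i \<bullet> b j))"
      by (intro sum.cong refl) (simp add: v_def min_def algebra_simps)
    also have "\<dots> = u k * ((\<Sum>i\<in>A. b i) \<bullet> (\<Sum>j\<in>A. b j)) +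
          (\<Sum>i\<in>A. \<Sum>j\<in>A. min (v i) (v j) * (b i \<bullet> b j))"
    proof -
      have "(\<Sum>i\<in>A. b i) \<bullet> (\<Sum>j\<in>A. b j) = (\<Sum>i\<in>A. \<Sum>j\<in>A. b i \<bullet> b j)"
        by (subst inner_sum_left) (simp only: inner_sum_right)
      then show ?thesis
        by (simp add: sum.distrib sum_distrib_left)
    qed
    also have "(\<Sum>i\<in>A. \<Sum>j\<in>A. min (v i) (v j) * (b i \<bullet> b j)) =
          (\<Sum>i\<in>A-{k}. \<Sum>j\<in>A-{k}. min (v i) (v j) * (b i \<bullet> b j))"
    proof -
      have "(\<Sum>j\<in>A. min (v i) (v j) * (b i \<bullet> b j)) =
            (\<Sum>j\<in>A-{k}. min (v i) (v j) * (b i \<bullet> b j))" if "i \<in> A" for i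
        using psubset.hyps that v0 k(1) by (intro sum.mono_neutral_right) auto
      moreover have "(\<Sum>j\<in>A-{k}. min (v k) (v j) * (b k \<bullet> b j)) = 0"
        using v0 k(1) by (intro sum.neutral) auto
      ultimately show ?thesis
        using psubset.hyps k(1) by (subst sum.remove[of A k]) auto
    qed
    also have "0 \<le> u k * ((\<Sum>i\<in>A. b i) \<bullet> (\<Sum>j\<in>A. b j)) + \<dots>"
      using k psubset.prems
      by (intro add_nonneg_nonneg mult_nonneg_nonneg psubset.IH) (auto simp: v_def)
    finally show ?thesis .
  qed simp
qed

text \<open>
  Up to positive weights in the two variables, the kernel is the minimum of two numbers:
  \<open>exp (-l |s - t|) = min (exp (2 l s)) (exp (2 l t)) * exp (-l s) * exp (-l t)\<close>.
\<close>

lemma exp_abs_kernel_nonneg: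
  fixes x :: "'i \<Rightarrow> real" and b :: "'i \<Rightarrow> 'v::real_inner"
  assumes "finite A" "0 \<le> l"
  shows "0 \<le> (\<Sum>i\<in>A. \<Sum>j\<in>A. exp (- l * \<bar>x i - x j\<bar>) * (b i \<bullet> b j))"
proof -
  have "exp (- l * \<bar>s - t\<bar>) =
        min (exp (2 * l * s)) (exp (2 * l * t)) * (exp (- l * s) * exp (- l * t))" for s t :: real
  proof (cases "s \<le> t")
    case True
    then have "min (exp (2 * l * s)) (exp (2 * l * t)) = exp (2 * l * s)"
      using assms by (simp add: mult_left_mono)
    with True show ?thesis by (simp add: mult_exp_exp algebra_simps)
  next
    case False
    then have "min (exp (2 * l * s)) (exp (2 * l * t)) = exp (2 * l * t)"
      using assms by (simp add: mult_left_mono)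
    with False show ?thesis by (simp add: mult_exp_exp algebra_simps)
  qed
  then have "(\<Sum>i\<in>A. \<Sum>j\<in>A. exp (- l * \<bar>x i - x j\<bar>) * (b i \<bullet> b j)) =
      (\<Sum>i\<in>A. \<Sum>j\<in>A. min (exp (2 * l * x i)) (exp (2 * l * x j)) *
         ((exp (- l * x i) *\<^sub>R b i) \<bullet> (exp (- l * x j) *\<^sub>R b j)))"
    by (intro sum.cong refl) (simp add: mult_ac)
  also have "0 \<le> \<dots>"
    by (rule min_kernel_nonneg) (use assms in auto)
  finally show ?thesis .
qed

text \<open>
  Positivity of the kernel \<open>E d = exp (-l |d|)\<close>, used for the doubled set of points \<open>\<xi> m\<close> and
  \<open>\<xi> m + \<delta>\<close> with the coefficient \<open>a m\<close> at both, says that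
  \<open>K d = 2 E(d) + E(d + \<delta>) + E(d - \<delta>)\<close> is a positive definite function. For \<open>|d| \<ge> \<delta>\<close> the
  three absolute values open with the same sign and \<open>K\<close> is a constant multiple of \<open>E\<close>, so off
  the diagonal it cannot be told from \<open>E\<close>. On the diagonal it is smaller than that multiple, and
  this is the gain. The Fourier transform of \<open>K\<close> is that of \<open>E\<close> times
  \<open>4 cos\<^sup>2(\<pi> \<delta> t)\<close>; it vanishes exactly at the frequencies of the alternating
  sequence on \<open>\<delta> \<int>\<close>, which is why nothing is lost in the extremal case.
\<close>

lemma exponential_form_lower_bound:
  fixes \<xi> :: "'i \<Rightarrow> real" and a :: "'i \<Rightarrow> 'v::real_inner"
  assumes fin: "finite I" and "0 < \<delta>" "0 < l"
    and sep: "\<And>m n. m \<in> I \<Longrightarrow> n \<in> I \<Longrightarrow> m \<noteq> n \<Longrightarrow> \<delta> \<le> \<bar>\<xi> m - \<xi> n\<bar>"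
  shows "- (2 * exp (- l * \<delta>) / (1 + exp (- l * \<delta>))) * (\<Sum>n\<in>I. (norm (a n))\<^sup>2) \<le>
         (\<Sum>m\<in>I. \<Sum>n\<in>I - {m}. exp (- l * \<bar>\<xi> m - \<xi> n\<bar>) * (a m \<bullet> a n))"
proof -
  define q where "q = exp (- l * \<delta>)"
  define E where "E d = exp (- l * \<bar>d\<bar>)" for d :: real
  define K where "K d = 2 * E d + E (d + \<delta>) + E (d - \<delta>)" for d
  let ?F = "\<Sum>m\<in>I. \<Sum>n\<in>I - {m}. E (\<xi> m - \<xi> n) * (a m \<bullet> a n)"
  let ?S = "\<Sum>n\<in>I. (norm (a n))\<^sup>2"
  have q: "q > 0" by (simp add: q_def)
  have K0: "K 0 = 2 * (1 + q)"
    using assms by (simp add: K_def E_def q_def)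
  have K1: "K d = (1 + q)\<^sup>2 / q * E d" if "\<delta> \<le> \<bar>d\<bar>" for d
  proof -
    have E1: "exp (- l * (\<bar>d\<bar> + \<delta>)) = q * E d" "exp (- l * (\<bar>d\<bar> - \<delta>)) = E d / q"
      by (simp_all add: E_def q_def mult_exp_exp exp_diff[symmetric] algebra_simps)
    have "\<bar>d + \<delta>\<bar> = \<bar>d\<bar> + \<delta> \<and> \<bar>d - \<delta>\<bar> = \<bar>d\<bar> - \<delta> \<or>
          \<bar>d + \<delta>\<bar> = \<bar>d\<bar> - \<delta> \<and> \<bar>d - \<delta>\<bar> = \<bar>d\<bar> + \<delta>"
      using that \<open>0 < \<delta>\<close> by linarith
    then have "E (d + \<delta>) + E (d - \<delta>) = q * E d + E d / q"
      unfolding E_def[of "d + \<delta>"] E_def[of "d - \<delta>"] by (auto simp only: E1)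
    then have "K d = (2 + (q + 1 / q)) * E d"
      unfolding K_def by (simp add: algebra_simps)
    also have "2 + (q + 1 / q) = (1 + q)\<^sup>2 / q"
      using q by (simp add: field_simps power2_eq_square)
    finally show ?thesis .
  qed
  have "0 \<le> (\<Sum>p\<in>I \<times> {0, \<delta>}. \<Sum>p'\<in>I \<times> {0, \<delta>}.
           exp (- l * \<bar>(\<xi> (fst p) + snd p) - (\<xi> (fst p') + snd p')\<bar>) * (a (fst p) \<bullet> a (fst p')))"
    using fin \<open>0 < l\<close> by (intro exp_abs_kernel_nonneg) auto
  also have "\<dots> = (\<Sum>p\<in>I \<times> {0, \<delta>}. \<Sum>n\<in>I. \<Sum>t\<in>{0, \<delta>}.
           E (\<xi> (fst p) + snd p - (\<xi> n + t)) * (a (fst p) \<bullet> a n))"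
    by (simp add: sum.cartesian_product' E_def)
  also have "\<dots> = (\<Sum>m\<in>I. \<Sum>s\<in>{0, \<delta>}. \<Sum>n\<in>I. \<Sum>t\<in>{0, \<delta>}.
           E (\<xi> m + s - (\<xi> n + t)) * (a m \<bullet> a n))"
    by (simp only: sum.cartesian_product' fst_conv snd_conv)
  also have "\<dots> = (\<Sum>m\<in>I. \<Sum>n\<in>I. K (\<xi> m - \<xi> n) * (a m \<bullet> a n))"
  proof (intro sum.cong refl)
    fix m
    show "(\<Sum>s\<in>{0, \<delta>}. \<Sum>n\<in>I. \<Sum>t\<in>{0, \<delta>}. E (\<xi> m + s - (\<xi> n + t)) * (a m \<bullet> a n)) =
          (\<Sum>n\<in>I. K (\<xi> m - \<xi> n) * (a m \<bullet> a n))"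
      using \<open>0 < \<delta>\<close> by (subst sum.swap) (simp add: K_def algebra_simps)
  qed
  also have "\<dots> = (\<Sum>m\<in>I. 2 * (1 + q) * (norm (a m))\<^sup>2 +
                    (\<Sum>n\<in>I - {m}. (1 + q)\<^sup>2 / q * (E (\<xi> m - \<xi> n) * (a m \<bullet> a n))))"
  proof (intro sum.cong refl)
    fix m assume m: "m \<in> I"
    have "(\<Sum>n\<in>I. K (\<xi> m - \<xi> n) * (a m \<bullet> a n)) =
          K 0 * (a m \<bullet> a m) + (\<Sum>n\<in>I - {m}. K (\<xi> m - \<xi> n) * (a m \<bullet> a n))"
      using fin m by (subst sum.remove[of _ m]) auto
    also have "(\<Sum>n\<in>I - {m}. K (\<xi> m - \<xi> n) * (a m \<bullet> a n)) =
               (\<Sum>n\<in>I - {m}. (1 + q)\<^sup>2 / q * (E (\<xi> m - \<xi> n) * (a m \<bullet> a n)))"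
      using sep m by (intro sum.cong refl) (subst K1, auto)
    finally show "(\<Sum>n\<in>I. K (\<xi> m - \<xi> n) * (a m \<bullet> a n)) = 2 * (1 + q) * (norm (a m))\<^sup>2 +
          (\<Sum>n\<in>I - {m}. (1 + q)\<^sup>2 / q * (E (\<xi> m - \<xi> n) * (a m \<bullet> a n)))"
      by (simp add: K0 power2_norm_eq_inner)
  qed
  also have "\<dots> = 2 * (1 + q) * ?S + (1 + q)\<^sup>2 / q * ?F"
    by (simp only: sum.distrib sum_distrib_left)
  also have "\<dots> = (1 + q)\<^sup>2 / q * (2 * q / (1 + q) * ?S + ?F)"
  proof -
    have "p\<^sup>2 / q * (2 * q / p) = 2 * p" if "p > 0" for p
      using q that by (simp add: field_simps power2_eq_square)
    from this[of "1 + q"] have "(1 + q)\<^sup>2 / q * (2 * q / (1 + q)) = 2 * (1 + q)"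
      using q by simp
    then show ?thesis
      by (simp only: distrib_left mult.assoc[symmetric])
  qed
  finally have "0 \<le> 2 * q / (1 + q) * ?S + ?F"
    using q by (simp add: zero_le_mult_iff zero_le_divide_iff)
  then show ?thesis
    by (simp add: q_def E_def)
qed

text \<open>
  For \<open>q < 1\<close> the left side is the alternating series \<open>q - q\<^sup>2 + q\<^sup>3 - \<dots>\<close>, here cut after a
  positive term. This replaces the constant of the preceding lemma by a finite sum of exponentials,
  which can be integrated in \<open>l\<close> termwise.
\<close>

lemma alternating_geometric_bound:
  fixes q :: real
  assumes "0 \<le> q"
  shows "q / (1 + q) \<le> (\<Sum>k<2 * K + 1. (-1) ^ k * q ^ Suc k)"
proof -
  define n where "n = 2 * K + 1"
  have "(\<Sum>k<n. (-1) ^ k * q ^ Suc k) = q * (\<Sum>k<n. (- q) ^ k)"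
    by (simp add: sum_distrib_left power_minus[of q] mult_ac)
  also have "(\<Sum>k<n. (- q) ^ k) = (1 + q ^ n) / (1 + q)"
    using assms sum_gp_strict[of "-q" n] by (simp add: n_def power_minus_odd)
  also have "q * \<dots> = q / (1 + q) + q * q ^ n / (1 + q)"
    by (simp add: distrib_left add_divide_distrib)
  finally show ?thesis
    using assms by (simp add: n_def)
qed

lemma Gamma_laplace_integral:
  fixes x \<sigma> :: real
  assumes "0 < x" "0 < \<sigma>"
  shows "((\<lambda>l. l powr (\<sigma> - 1) * exp (- l * x)) has_integral Gamma \<sigma> * x powr - \<sigma>) {0..}"
proof -
  let ?f = "\<lambda>t::real. t powr (\<sigma> - 1) / exp t"
  have im: "(*) x ` {0..} = {0..}"
    using assms by (auto simp: image_iff intro!: bexI[of _ "_ / x"])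
  have "?f absolutely_integrable_on {0..}"
    using Gamma_integral_real[OF assms(2)]
    by (intro nonnegative_absolutely_integrable_1) (auto simp: has_integral_iff)
  moreover have "integral {0..} ?f = Gamma \<sigma>"
    using Gamma_integral_real[OF assms(2)] by (rule integral_unique)
  moreover have "(\<lambda>l. \<bar>x\<bar> * ?f (x * l)) absolutely_integrable_on {0..} \<and>
             integral {0..} (\<lambda>l. \<bar>x\<bar> * ?f (x * l)) = Gamma \<sigma> \<longleftrightarrow>
             ?f absolutely_integrable_on (*) x ` {0..} \<and> integral ((*) x ` {0..}) ?f = Gamma \<sigma>"
  proof (rule has_absolute_integral_change_of_variables_1')
    show "((*) x has_field_derivative x) (at t within {0..})" for t
      by (auto intro!: derivative_eq_intros)
    show "inj_on ((*) x) {0..}"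
      using assms(1) by (simp add: inj_on_def)
  qed simp
  ultimately have "(\<lambda>l. \<bar>x\<bar> * ?f (x * l)) absolutely_integrable_on {0..} \<and>
             integral {0..} (\<lambda>l. \<bar>x\<bar> * ?f (x * l)) = Gamma \<sigma>"
    by (simp only: im simp_thms)
  then have "((\<lambda>l. x * ?f (x * l)) has_integral Gamma \<sigma>) {0..}"
    using assms(1) set_lebesgue_integral_eq_integral(1) by (fastforce simp: has_integral_iff)
  then have "((\<lambda>l. x powr - \<sigma> * (x * ?f (x * l))) has_integral x powr - \<sigma> * Gamma \<sigma>) {0..}"
    by (rule has_integral_mult_right)
  moreover have "x powr - \<sigma> * (x * ?f (x * l)) = l powr (\<sigma> - 1) * exp (- l * x)"
    if "l \<in> {0..}" for l
  proof -
    have "x powr - \<sigma> * (x * ?f (x * l)) =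
          (x powr - \<sigma> * x powr 1 * x powr (\<sigma> - 1)) * l powr (\<sigma> - 1) / exp (x * l)"
      using assms that by (simp add: powr_mult)
    also have "x powr - \<sigma> * x powr 1 * x powr (\<sigma> - 1) = 1"
      using assms by (simp only: powr_add[symmetric]) simp
    finally show ?thesis by (simp add: exp_minus field_simps)
  qed
  ultimately have "((\<lambda>l. l powr (\<sigma> - 1) * exp (- l * x)) has_integral x powr - \<sigma> * Gamma \<sigma>) {0..}"
    by (rule has_integral_eq[rotated])
  then show ?thesis
    by (simp only: mult.commute)
qed

text \<open>
  The power \<open>x powr - \<sigma>\<close> is a positive mixture of the exponentials \<open>exp (- l * x)\<close>, with weight
  \<open>l powr (\<sigma> - 1) / Gamma \<sigma>\<close> on \<open>l > 0\<close>. This is where all exponents \<open>\<sigma> > 0\<close> are treated at once.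
\<close>

lemma power_sum_le_of_exponential_sum_le:
  fixes c x :: "'i \<Rightarrow> real" and d y :: "'j \<Rightarrow> real"
  assumes le: "\<And>l. 0 < l \<Longrightarrow>
      (\<Sum>i\<in>I. c i * exp (- l * x i)) \<le> (\<Sum>j\<in>J. d j * exp (- l * y j))"
    and pos: "\<And>i. i \<in> I \<Longrightarrow> 0 < x i" "\<And>j. j \<in> J \<Longrightarrow> 0 < y j"
    and fin: "finite I" "finite J" and "0 < \<sigma>"
  shows "(\<Sum>i\<in>I. c i * x i powr - \<sigma>) \<le> (\<Sum>j\<in>J. d j * y j powr - \<sigma>)"
proof -
  have I: "((\<lambda>l. \<Sum>i\<in>A. e i * (l powr (\<sigma> - 1) * exp (- l * z i))) has_integral
          (\<Sum>i\<in>A. e i * (Gamma \<sigma> * z i powr - \<sigma>))) {0..}"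
    if "finite A" "\<And>i. i \<in> A \<Longrightarrow> 0 < z i" for A e z
    using that \<open>0 < \<sigma>\<close>
    by (intro has_integral_sum has_integral_mult_right Gamma_laplace_integral) auto
  have "(\<Sum>i\<in>I. c i * (Gamma \<sigma> * x i powr - \<sigma>)) \<le> (\<Sum>j\<in>J. d j * (Gamma \<sigma> * y j powr - \<sigma>))"
  proof (rule has_integral_le[OF I I])
    fix l :: real assume "l \<in> {0..}"
    show "(\<Sum>i\<in>I. c i * (l powr (\<sigma> - 1) * exp (- l * x i))) \<le>
          (\<Sum>j\<in>J. d j * (l powr (\<sigma> - 1) * exp (- l * y j)))"
    proof (cases "l = 0")
      case False
      then have "l powr (\<sigma> - 1) * (\<Sum>i\<in>I. c i * exp (- l * x i)) \<le>
                 l powr (\<sigma> - 1) * (\<Sum>j\<in>J. d j * exp (- l * y j))"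
        using \<open>l \<in> {0..}\<close> le by (intro mult_left_mono) auto
      then show ?thesis by (simp add: sum_distrib_left mult_ac)
    qed simp
  qed (use pos fin in auto)
  then have "Gamma \<sigma> * (\<Sum>i\<in>I. c i * x i powr - \<sigma>) \<le> Gamma \<sigma> * (\<Sum>j\<in>J. d j * y j powr - \<sigma>)"
    by (simp add: sum_distrib_left mult_ac)
  then show ?thesis
    using Gamma_real_pos[OF \<open>0 < \<sigma>\<close>] by simp
qed

section \<open>The zeta function to the right of the imaginary axis\<close>

text \<open>
  The subtracted difference is the integral of \<open>w powr - z\<close> over \<open>[x, x + 1]\<close>. The error of replacing
  it by the value at the left end point gains a factor \<open>1 / x\<close>, which is what makes the increments
  of the partial sums below summable for all \<open>Re z > 0\<close>.
\<close>

lemma power_minus_integral_bound: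
  fixes x :: real and z :: complex
  assumes "0 < x" "0 < Re z" "z \<noteq> 1"
  shows "norm (1 / of_real x powr z -
               (of_real (x + 1) powr (1 - z) / (1 - z) - of_real x powr (1 - z) / (1 - z)))
           \<le> norm z * x powr (- Re z - 1)"
proof -
  let ?S = "closed_segment (complex_of_real x) (of_real (x + 1))"
  define F :: "nat \<Rightarrow> complex \<Rightarrow> complex" where
    "F i w = (if i = 0 then w powr (1 - z) / (1 - z)
              else if i = 1 then w powr (- z) else - z * w powr (- z - 1))" for i w
  have S: "\<exists>t. w = of_real t \<and> x \<le> t" if "w \<in> ?S" for w
    using that assms by (auto simp: closed_segment_of_real closed_segment_eq_real_ivl simp del: of_real_add)
  have "norm (F 0 (of_real (x + 1)) -
          (\<Sum>i\<le>1. F i (of_real x) * (of_real (x + 1) - of_real x) ^ i / fact i))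
        \<le> norm z * x powr (- Re z - 1) * norm (of_real (x + 1) - complex_of_real x) ^ Suc 1 / fact 1"
  proof (rule complex_Taylor[where S = ?S])
    fix i w assume w: "w \<in> ?S" and i: "i \<le> (1::nat)"
    obtain t where "w = of_real t" "x \<le> t"
      using S[OF w] by blast
    then have nonpos: "w \<notin> \<real>\<^sub>\<le>\<^sub>0"
      using assms by simp
    have "((\<lambda>w. w powr (1 - z) / (1 - z)) has_field_derivative w powr - z) (at w)"
      "((\<lambda>w. w powr - z) has_field_derivative - z * w powr (- z - 1)) (at w)"
      using nonpos \<open>z \<noteq> 1\<close> by (auto intro!: derivative_eq_intros)
    then have "(F 0 has_field_derivative F 1 w) (at w)" "(F 1 has_field_derivative F 2 w) (at w)"
      by (simp_all add: F_def[abs_def])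
    then show "(F i has_field_derivative F (Suc i) w) (at w within ?S)"
      using i by (cases i) (auto simp: numeral_2_eq_2 intro: has_field_derivative_at_within)
  next
    fix w assume "w \<in> ?S"
    then obtain t where t: "w = of_real t" "x \<le> t"
      using S by blast
    have "t powr (- Re z - 1) \<le> x powr (- Re z - 1)"
      using t assms by (intro powr_mono2') auto
    then show "norm (F (Suc 1) w) \<le> norm z * x powr (- Re z - 1)"
      using t assms by (auto simp: F_def norm_mult norm_powr_real_powr intro!: mult_left_mono)
  qed auto
  then show ?thesis
    by (simp add: F_def powr_minus_divide norm_minus_commute algebra_simps)
qed

text \<open>
  Subtracting the antiderivative of \<open>x powr - z\<close> at \<open>N + 1\<close> removes the growth of the partial
  sum. Taking the antiderivative without the constant that makes it vanish at \<open>1\<close> lets the limit be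
  \<open>zeta z\<close> itself, with no correction term \<open>1 / (z - 1)\<close>.
\<close>

definition zeta_partial :: "nat \<Rightarrow> complex \<Rightarrow> complex" where
  "zeta_partial N z =
     (\<Sum>n<N. 1 / of_nat (Suc n) powr z) - of_nat (Suc N) powr (1 - z) / (1 - z)"

lemma zeta_partial_uniform_limit:
  assumes "cball x d \<subseteq> {z. Re z > 0} - {1}" "0 < d"
  shows "uniform_limit (cball x d) zeta_partial (\<lambda>z. lim (\<lambda>N. zeta_partial N z)) sequentially"
proof -
  define c where "c = Re x - d"
  define M where "M n = (norm x + d) * of_nat (Suc n) powr (- c - 1)" for n
  let ?h = "\<lambda>n z. zeta_partial (Suc n) z - zeta_partial n z"
  have "x - of_real d \<in> cball x d"
    using assms(2) by (simp add: dist_norm)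
  then have "0 < Re (x - of_real d)"
    using assms(1) by blast
  then have c: "c > 0"
    by (simp add: c_def)
  have "uniform_limit (cball x d) (\<lambda>N z. \<Sum>n<N. ?h n z) (\<lambda>z. suminf (\<lambda>n. ?h n z)) sequentially"
  proof (rule Weierstrass_m_test)
    have "summable (\<lambda>n. of_nat n powr (- c - 1) :: real)"
      using c by (simp add: summable_real_powr_iff)
    then show "summable M"
      unfolding M_def by (intro summable_mult) (subst summable_Suc_iff)
  next
    fix n z assume z: "z \<in> cball x d"
    have "norm z \<le> norm x + d"
      using z norm_triangle_ineq2[of z x] by (simp add: dist_norm norm_minus_commute)
    moreover have "c \<le> Re z"
      using z abs_Re_le_cmod[of "x - z"] by (auto simp: c_def dist_norm)
    then have "real (Suc n) powr (- Re z - 1) \<le> real (Suc n) powr (- c - 1)"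
      by (intro powr_mono) auto
    ultimately have "norm z * real (Suc n) powr (- Re z - 1) \<le> M n"
      unfolding M_def using assms(2) by (intro mult_mono) auto
    moreover have "0 < Re z" "z \<noteq> 1"
      using z assms by auto
    then have "norm (?h n z) \<le> norm z * real (Suc n) powr (- Re z - 1)"
      using power_minus_integral_bound[of "real (Suc n)" z]
      by (simp add: zeta_partial_def algebra_simps)
    ultimately show "norm (?h n z) \<le> M n" by linarith
  qed
  then have "uniform_limit (cball x d) (\<lambda>N z. zeta_partial 0 z + (\<Sum>n<N. ?h n z))
               (\<lambda>z. zeta_partial 0 z + suminf (\<lambda>n. ?h n z)) sequentially"
    by (intro uniform_limit_add uniform_limit_const)
  moreover have "zeta_partial 0 z + (\<Sum>n<N. ?h n z) = zeta_partial N z" for N z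
    using sum_lessThan_telescope[of "\<lambda>n. zeta_partial n z" N] by simp
  ultimately have "uniformly_convergent_on (cball x d) zeta_partial"
    unfolding uniformly_convergent_on_def by auto
  then show ?thesis
    by (simp add: uniformly_convergent_uniform_limit_iff)
qed

lemma halfplane_punctured_cball:
  assumes "x \<in> {z. Re z > 0} - {1}"
  obtains d where "0 < d" "cball x d \<subseteq> {z. Re z > 0} - {1}"
proof -
  have "open ({z. Re z > 0} - {1})"
    by (intro open_Diff open_halfspace_Re_gt) auto
  then show thesis
    using assms that open_contains_cball by blast
qed

lemma zeta_partial_tendsto_lim:
  assumes "0 < Re s" "s \<noteq> 1"
  shows "(\<lambda>N. zeta_partial N s) \<longlonglongrightarrow> lim (\<lambda>N. zeta_partial N s)"
proof -
  obtain d where "0 < d" "cball s d \<subseteq> {z. Re z > 0} - {1}"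
    using halfplane_punctured_cball[of s] assms by auto
  then show ?thesis
    using tendsto_uniform_limitI[OF zeta_partial_uniform_limit, of s d s] by simp
qed

lemma zeta_continuation_zeta_partial: "zeta_continuation 0 (\<lambda>z. lim (\<lambda>N. zeta_partial N z))"
  unfolding zeta_continuation_def
proof (intro conjI allI impI)
  show "(\<lambda>z. lim (\<lambda>N. zeta_partial N z)) holomorphic_on {z. Re z > 0} - {1}"
  proof (rule holomorphic_uniform_sequence[of _ zeta_partial])
    show "open ({z. Re z > 0} - {1})"
      by (intro open_Diff open_halfspace_Re_gt) auto
    show "zeta_partial N holomorphic_on {z. Re z > 0} - {1}" for N
      unfolding zeta_partial_def by (intro holomorphic_intros) (auto simp del: of_nat_Suc)
    show "\<exists>d>0. cball x d \<subseteq> {z. Re z > 0} - {1} \<and>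
            uniform_limit (cball x d) zeta_partial (\<lambda>z. lim (\<lambda>N. zeta_partial N z)) sequentially"
      if "x \<in> {z. Re z > 0} - {1}" for x
      using halfplane_punctured_cball[OF that] zeta_partial_uniform_limit by metis
  qed
next
  fix z :: complex assume z: "1 < Re z"
  have "(\<lambda>N. real (Suc N) powr (1 - Re z)) \<longlonglongrightarrow> 0"
    using z by real_asymp
  then have "(\<lambda>N. norm (of_nat (Suc N) powr (1 - z))) \<longlonglongrightarrow> 0"
    by (simp add: norm_powr_real_powr del: of_nat_Suc)
  then have "(\<lambda>N. of_nat (Suc N) powr (1 - z) / (1 - z)) \<longlonglongrightarrow> 0 / (1 - z)"
    using z by (intro tendsto_divide tendsto_const) (auto simp: tendsto_norm_zero_iff)
  moreover have "(\<lambda>N. zeta_partial N z) \<longlonglongrightarrow> lim (\<lambda>N. zeta_partial N z)"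
    using z by (intro zeta_partial_tendsto_lim) auto
  ultimately have "(\<lambda>N. zeta_partial N z + of_nat (Suc N) powr (1 - z) / (1 - z))
                     \<longlonglongrightarrow> lim (\<lambda>N. zeta_partial N z) + 0 / (1 - z)"
    by (intro tendsto_add)
  then show "(\<lambda>n. 1 / of_nat (Suc n) powr z) sums lim (\<lambda>N. zeta_partial N z)"
    by (simp add: sums_def zeta_partial_def)
qed

lemma zeta_partial_tendsto_zeta:
  assumes "0 < Re s" "s \<noteq> 1"
  shows "(\<lambda>N. zeta_partial N s) \<longlonglongrightarrow> zeta s"
  using zeta_partial_tendsto_lim[OF assms] zeta_eqI[OF zeta_continuation_zeta_partial assms] by simp

lemma Re_of_nat_powr_of_real: "Re (of_nat n powr of_real s) = real n powr s"
  by (metis Re_complex_of_real of_nat_0_le_iff of_real_of_nat_eq powr_of_real)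

lemma Re_zeta_partial:
  "Re (zeta_partial N (of_real \<sigma>)) =
     (\<Sum>n<N. real (Suc n) powr - \<sigma>) - real (Suc N) powr (1 - \<sigma>) / (1 - \<sigma>)"
proof -
  have "Re (1 / of_nat (Suc n) powr of_real \<sigma>) = real (Suc n) powr - \<sigma>" for n
    using Re_of_nat_powr_of_real[of "Suc n" "- \<sigma>"]
    by (simp add: powr_minus_divide del: of_nat_Suc)
  moreover have "Re (of_nat (Suc N) powr (1 - of_real \<sigma>) / (1 - of_real \<sigma>)) =
                 real (Suc N) powr (1 - \<sigma>) / (1 - \<sigma>)"
    using Re_of_nat_powr_of_real[of "Suc N" "1 - \<sigma>"]
    by (metis Re_divide_of_real of_real_1 of_real_diff)
  ultimately show ?thesis
    unfolding zeta_partial_def minus_complex.sel Re_sum by presburger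
qed

lemma powr_sums_zeta:
  assumes "1 < \<sigma>"
  shows "(\<lambda>n. real (Suc n) powr - \<sigma>) sums Re (zeta (of_real \<sigma>))"
proof -
  have "(\<lambda>N. Re (zeta_partial N (of_real \<sigma>))) \<longlonglongrightarrow> Re (zeta (of_real \<sigma>))"
    using assms by (intro tendsto_Re zeta_partial_tendsto_zeta) auto
  moreover have "(\<lambda>N. real (Suc N) powr (1 - \<sigma>) / (1 - \<sigma>)) \<longlonglongrightarrow> 0"
    using assms by real_asymp
  ultimately have "(\<lambda>N. Re (zeta_partial N (of_real \<sigma>)) + real (Suc N) powr (1 - \<sigma>) / (1 - \<sigma>))
                     \<longlonglongrightarrow> Re (zeta (of_real \<sigma>)) + 0"
    by (rule tendsto_add)
  then show ?thesis
    by (simp add: Re_zeta_partial sums_def)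
qed

text \<open>
  Changing the sign of the even-numbered terms subtracts each of them twice, and these terms form a
  scaled copy of the first half of the same sum.
\<close>

lemma alternating_sum_split:
  "(\<Sum>k<2 * N. (-1) ^ k * real (Suc k) powr - \<sigma>) =
   (\<Sum>k<2 * N. real (Suc k) powr - \<sigma>) - 2 powr (1 - \<sigma>) * (\<Sum>k<N. real (Suc k) powr - \<sigma>)"
proof (induction N)
  case (Suc N)
  have "real (2 * Suc N) powr - \<sigma> = 2 powr - \<sigma> * real (Suc N) powr - \<sigma>"
    by (subst powr_mult[symmetric]) auto
  moreover have "2 powr (1 - \<sigma>) = 2 * 2 powr - \<sigma>"
    by (simp add: powr_diff powr_minus_divide)
  ultimately show ?case
    using Suc.IH by (simp add: algebra_simps)
qed simp

lemma summable_alternating_powr: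
  fixes \<sigma> :: real
  assumes "0 < \<sigma>"
  shows "summable (\<lambda>k. (-1) ^ k * real (Suc k) powr - \<sigma>)"
proof (rule summable_Leibniz'(1))
  show "(\<lambda>k. real (Suc k) powr - \<sigma>) \<longlonglongrightarrow> 0"
    using assms by real_asymp
qed (use assms in \<open>auto intro!: powr_mono2'\<close>)

text \<open>
  For \<open>\<sigma> < 1\<close> both sums in the splitting above diverge, but their main terms
  \<open>(2 N + 2) powr (1 - \<sigma>) / (1 - \<sigma>)\<close> and \<open>2 powr (1 - \<sigma>) * (N + 1) powr (1 - \<sigma>) / (1 - \<sigma>)\<close> are
  equal. Hence the limit can be read off from the regularised partial sums on the real axis.
\<close>

lemma alternating_powr_sums_zeta:
  assumes "0 < \<sigma>" "\<sigma> \<noteq> 1"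
  shows "(\<lambda>k. (-1) ^ k * real (Suc k) powr - \<sigma>) sums ((1 - 2 powr (1 - \<sigma>)) * Re (zeta (of_real \<sigma>)))"
proof -
  let ?Z = "Re (zeta (of_real \<sigma>))"
  let ?P = "\<lambda>N. Re (zeta_partial N (of_real \<sigma>))"
  let ?L = "\<Sum>k. (-1) ^ k * real (Suc k) powr - \<sigma>"
  have sums: "(\<lambda>k. (-1) ^ k * real (Suc k) powr - \<sigma>) sums ?L"
    using assms summable_alternating_powr by (intro summable_sums) auto
  have even: "filterlim (\<lambda>N::nat. 2 * N) sequentially sequentially"
    by (rule mult_nat_left_at_top) simp
  have P: "?P \<longlonglongrightarrow> ?Z"
    using assms by (intro tendsto_Re zeta_partial_tendsto_zeta) auto
  \<comment> \<open>The index \<open>2 N + 1\<close> instead of \<open>2 N\<close> makes the main terms cancel exactly.\<close>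
  have "(\<lambda>N. ?P (Suc (2 * N)) - real (2 * N + 1) powr - \<sigma> - 2 powr (1 - \<sigma>) * ?P N)
        \<longlonglongrightarrow> ?Z - 0 - 2 powr (1 - \<sigma>) * ?Z"
  proof (intro tendsto_diff tendsto_mult tendsto_const P)
    show "(\<lambda>N. ?P (Suc (2 * N))) \<longlonglongrightarrow> ?Z"
      using filterlim_compose[OF LIMSEQ_Suc[OF P] even] .
    show "(\<lambda>N. real (2 * N + 1) powr - \<sigma>) \<longlonglongrightarrow> 0"
      using assms by real_asymp
  qed
  moreover have "?P (Suc (2 * N)) - real (2 * N + 1) powr - \<sigma> - 2 powr (1 - \<sigma>) * ?P N =
        (\<Sum>k<2 * N. (-1) ^ k * real (Suc k) powr - \<sigma>)" for N
  proof -
    have "real (Suc (Suc (2 * N))) powr (1 - \<sigma>) = 2 powr (1 - \<sigma>) * real (Suc N) powr (1 - \<sigma>)"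
      by (subst powr_mult[symmetric]) (auto simp: algebra_simps)
    then show ?thesis
      unfolding alternating_sum_split Re_zeta_partial
      by (simp add: right_diff_distrib add_ac)
  qed
  ultimately have "(\<lambda>N. \<Sum>k<2 * N. (-1) ^ k * real (Suc k) powr - \<sigma>)
                     \<longlonglongrightarrow> (1 - 2 powr (1 - \<sigma>)) * ?Z"
    by (simp add: algebra_simps)
  moreover have "(\<lambda>N. \<Sum>k<2 * N. (-1) ^ k * real (Suc k) powr - \<sigma>) \<longlonglongrightarrow> ?L"
    using sums even unfolding sums_def by (rule filterlim_compose)
  ultimately have "?L = (1 - 2 powr (1 - \<sigma>)) * ?Z"
    by (rule LIMSEQ_unique[rotated])
  then show ?thesis
    using sums by simp
qed

section \<open>The bounds for the forms\<close>

lemma Re_hermitian_form: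
  "Re (hermitian_form \<sigma> N \<xi> a) =
     (\<Sum>m\<in>{1..N}. \<Sum>n\<in>{1..N} - {m}. \<bar>\<xi> m - \<xi> n\<bar> powr - \<sigma> * (a m \<bullet> a n))"
  unfolding hermitian_form_def Re_sum
  by (intro sum.cong refl) (simp add: inner_complex_def powr_minus_divide)

text \<open>
  For each \<open>l\<close> the exponential form is at least \<open>- 2 q / (1 + q)\<close> times the sum of squares, where
  \<open>q = exp (- l * \<delta>)\<close>, hence at least \<open>-2\<close> times that sum times a finite
  alternating sum of the exponentials \<open>exp (- l * (\<delta> * k))\<close>. Mixing over \<open>l\<close> turns this into the partial sums of the alternating
  series, and these tend to \<open>L\<close>. Cutting the series before the integration makes this work in the
  conditionally convergent range \<open>\<sigma> \<le> 1\<close> as well.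
\<close>

lemma lower_constant_alternating_series:
  assumes "0 < \<delta>" "0 < \<sigma>"
    and L: "(\<lambda>k. (-1) ^ k * real (Suc k) powr - \<sigma>) sums L"
  shows "lower_constant \<sigma> \<delta> (2 * L / \<delta> powr \<sigma>)"
  unfolding lower_constant_def
proof (intro allI impI)
  fix N :: nat and \<xi> :: "nat \<Rightarrow> real" and a :: "nat \<Rightarrow> complex"
  assume "separated \<delta> N \<xi>"
  then have sep: "\<delta> \<le> \<bar>\<xi> m - \<xi> n\<bar>" if "m \<in> {1..N}" "n \<in> {1..N}" "m \<noteq> n" for m n
    using that by (auto simp: separated_def)
  let ?S = "\<Sum>n\<in>{1..N}. (norm (a n))\<^sup>2"
  let ?I = "Sigma {1..N} (\<lambda>m. {1..N} - {m})"
  let ?F = "Re (hermitian_form \<sigma> N \<xi> a)"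
  have S: "0 \<le> ?S" by (simp add: sum_nonneg)
  have bound: "- (2 * ?S) * (\<Sum>k<2 * K + 1. (-1) ^ k * (\<delta> * real (Suc k)) powr - \<sigma>) \<le> ?F" for K
  proof -
    have "(\<Sum>k<2 * K + 1. (- (2 * ?S) * (-1) ^ k) * (\<delta> * real (Suc k)) powr - \<sigma>) \<le>
          (\<Sum>p\<in>?I. (a (fst p) \<bullet> a (snd p)) * \<bar>\<xi> (fst p) - \<xi> (snd p)\<bar> powr - \<sigma>)"
    proof (rule power_sum_le_of_exponential_sum_le)
      fix l :: real assume l: "0 < l"
      let ?q = "exp (- l * \<delta>)"
      have "?q ^ Suc k = exp (- l * (\<delta> * real (Suc k)))" for k
        by (subst exp_of_nat_mult[symmetric]) (simp add: mult_ac)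
      then have "(\<Sum>k<2 * K + 1. (- (2 * ?S) * (-1) ^ k) * exp (- l * (\<delta> * real (Suc k)))) =
            - (2 * ?S) * (\<Sum>k<2 * K + 1. (-1) ^ k * ?q ^ Suc k)"
        by (simp only: sum_distrib_left mult.assoc)
      also have "\<dots> \<le> - (2 * ?S) * (?q / (1 + ?q))"
        using S by (intro mult_left_mono_neg alternating_geometric_bound) auto
      also have "\<dots> = - (2 * ?q / (1 + ?q)) * ?S"
        by simp
      also have "\<dots> \<le> (\<Sum>m\<in>{1..N}. \<Sum>n\<in>{1..N} - {m}. exp (- l * \<bar>\<xi> m - \<xi> n\<bar>) * (a m \<bullet> a n))"
        using l assms(1) sep by (intro exponential_form_lower_bound) auto
      also have "\<dots> = (\<Sum>p\<in>?I. (a (fst p) \<bullet> a (snd p)) * exp (- l * \<bar>\<xi> (fst p) - \<xi> (snd p)\<bar>))"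
        by (subst sum.Sigma) (auto simp: mult.commute case_prod_unfold)
      finally show "(\<Sum>k<2 * K + 1. (- (2 * ?S) * (-1) ^ k) * exp (- l * (\<delta> * real (Suc k)))) \<le> \<dots>" .
    next
      fix p assume "p \<in> ?I"
      then show "0 < \<bar>\<xi> (fst p) - \<xi> (snd p)\<bar>"
        using sep[of "fst p" "snd p"] assms(1) by auto
    qed (use assms in auto)
    also have "\<dots> = ?F"
      unfolding Re_hermitian_form by (subst sum.Sigma) (auto simp: mult.commute case_prod_unfold)
    finally show ?thesis
      by (simp only: sum_distrib_left mult.assoc)
  qed
  have "(\<lambda>K. \<Sum>k<2 * K + 1. (-1) ^ k * real (Suc k) powr - \<sigma>) \<longlonglongrightarrow> L"
  proof (rule filterlim_compose[OF L[unfolded sums_def]])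
    show "filterlim (\<lambda>K::nat. 2 * K + 1) sequentially sequentially"
      by real_asymp
  qed
  then have "(\<lambda>K. - (2 * ?S) * (\<delta> powr - \<sigma> * (\<Sum>k<2 * K + 1. (-1) ^ k * real (Suc k) powr - \<sigma>)))
      \<longlonglongrightarrow> - (2 * ?S) * (\<delta> powr - \<sigma> * L)"
    by (intro tendsto_intros)
  moreover have "\<delta> powr - \<sigma> * (\<Sum>k<2 * K + 1. (-1) ^ k * real (Suc k) powr - \<sigma>) =
      (\<Sum>k<2 * K + 1. (-1) ^ k * (\<delta> * real (Suc k)) powr - \<sigma>)" for K
    unfolding sum_distrib_left using assms
    by (intro sum.cong refl) (simp add: powr_mult mult_ac del: of_nat_Suc)
  ultimately have "- (2 * ?S) * (\<delta> powr - \<sigma> * L) \<le> ?F"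
    using bound by (intro LIMSEQ_le_const2) auto
  then show "- (2 * L / \<delta> powr \<sigma>) * ?S \<le> ?F"
    by (simp add: powr_minus_divide mult_ac)
qed

text \<open>
  On either side of \<open>\<xi> m\<close> distinct points have distinct values of \<open>\<lfloor>|\<xi> m - \<xi> n| / \<delta>\<rfloor> \<ge> 1\<close>, so
  that each side is dominated by the full series.
\<close>

lemma separated_row_sum_bound:
  assumes "0 < \<delta>" "0 < \<sigma>" and sep: "separated \<delta> N \<xi>" and m: "m \<in> {1..N}"
    and Z: "(\<lambda>k. real (Suc k) powr - \<sigma>) sums Z"
  shows "(\<Sum>n\<in>{1..N} - {m}. \<bar>\<xi> m - \<xi> n\<bar> powr - \<sigma>) \<le> 2 * Z / \<delta> powr \<sigma>"
proof -
  have half: "(\<Sum>n\<in>B. \<bar>\<xi> m - \<xi> n\<bar> powr - \<sigma>) \<le> \<delta> powr - \<sigma> * Z"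
    if B: "B \<subseteq> {1..N} - {m}"
      and side: "\<And>n n'. n \<in> B \<Longrightarrow> n' \<in> B \<Longrightarrow> \<bar>\<xi> n - \<xi> n'\<bar> = \<bar>\<bar>\<xi> m - \<xi> n\<bar> - \<bar>\<xi> m - \<xi> n'\<bar>\<bar>" for B
  proof -
    \<comment> \<open>Shifted by one, because the series starts at index \<open>0\<close>.\<close>
    define h where "h n = nat \<lfloor>\<bar>\<xi> m - \<xi> n\<bar> / \<delta>\<rfloor> - 1" for n
    have fin: "finite B" using B by (rule finite_subset) simp
    have dist: "\<delta> \<le> \<bar>\<xi> i - \<xi> j\<bar>" if "i \<in> insert m B" "j \<in> insert m B" "i \<noteq> j" for i j
    proof -
      have "i \<in> {1..N}" "j \<in> {1..N}" using that B m by auto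
      then show ?thesis using sep that(3) by (simp add: separated_def)
    qed
    have ge: "1 \<le> \<bar>\<xi> m - \<xi> n\<bar> / \<delta>" if "n \<in> B" for n
      using dist[of m n] B that assms(1) by auto
    have Suc_h: "real (Suc (h n)) = of_int \<lfloor>\<bar>\<xi> m - \<xi> n\<bar> / \<delta>\<rfloor>" if "n \<in> B" for n
    proof -
      have "1 \<le> \<lfloor>\<bar>\<xi> m - \<xi> n\<bar> / \<delta>\<rfloor>" using ge[OF that] by (simp add: le_floor_iff)
      then have "int (Suc (h n)) = \<lfloor>\<bar>\<xi> m - \<xi> n\<bar> / \<delta>\<rfloor>" by (simp add: h_def)
      then have "real_of_int (int (Suc (h n))) = of_int \<lfloor>\<bar>\<xi> m - \<xi> n\<bar> / \<delta>\<rfloor>" by simp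
      then show ?thesis by simp
    qed
    have "inj_on h B"
    proof (rule inj_onI, rule ccontr)
      fix n n' assume n: "n \<in> B" "n' \<in> B" "h n = h n'" "n \<noteq> n'"
      have "\<bar>\<bar>\<xi> m - \<xi> n\<bar> / \<delta> - \<bar>\<xi> m - \<xi> n'\<bar> / \<delta>\<bar> < 1"
        using Suc_h[OF n(1)] Suc_h[OF n(2)] n(3) by linarith
      also have "\<bar>\<bar>\<xi> m - \<xi> n\<bar> / \<delta> - \<bar>\<xi> m - \<xi> n'\<bar> / \<delta>\<bar> = \<bar>\<xi> n - \<xi> n'\<bar> / \<delta>"
        using side[OF n(1,2)] assms(1) by (simp add: diff_divide_distrib[symmetric] abs_divide)
      finally have "\<bar>\<xi> n - \<xi> n'\<bar> < \<delta>"
        using assms(1) by (simp add: divide_less_eq)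
      moreover have "\<delta> \<le> \<bar>\<xi> n - \<xi> n'\<bar>"
        using dist[of n n'] n by simp
      ultimately show False by simp
    qed
    have "(\<Sum>n\<in>B. \<bar>\<xi> m - \<xi> n\<bar> powr - \<sigma>) \<le> (\<Sum>n\<in>B. \<delta> powr - \<sigma> * real (Suc (h n)) powr - \<sigma>)"
    proof (rule sum_mono)
      fix n assume n: "n \<in> B"
      have "real (Suc (h n)) \<le> \<bar>\<xi> m - \<xi> n\<bar> / \<delta>"
        unfolding Suc_h[OF n] by simp
      then have "\<delta> * real (Suc (h n)) \<le> \<bar>\<xi> m - \<xi> n\<bar>"
        using assms(1) by (simp add: field_simps)
      then have "\<bar>\<xi> m - \<xi> n\<bar> powr - \<sigma> \<le> (\<delta> * real (Suc (h n))) powr - \<sigma>"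
        using assms by (intro powr_mono2') auto
      then show "\<bar>\<xi> m - \<xi> n\<bar> powr - \<sigma> \<le> \<delta> powr - \<sigma> * real (Suc (h n)) powr - \<sigma>"
        using assms by (simp add: powr_mult del: of_nat_Suc)
    qed
    also have "\<dots> = \<delta> powr - \<sigma> * (\<Sum>k\<in>h ` B. real (Suc k) powr - \<sigma>)"
      using \<open>inj_on h B\<close> by (simp add: sum.reindex sum_distrib_left)
    also have "(\<Sum>k\<in>h ` B. real (Suc k) powr - \<sigma>) \<le> Z"
      using Z fin sum_le_suminf[of "\<lambda>k. real (Suc k) powr - \<sigma>" "h ` B"] by (auto simp: sums_iff)
    finally show ?thesis by (simp add: mult_left_mono)
  qed
  let ?L = "{n \<in> {1..N} - {m}. \<xi> n \<le> \<xi> m}" and ?R = "{n \<in> {1..N} - {m}. \<not> \<xi> n \<le> \<xi> m}"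
  have "(\<Sum>n\<in>{1..N} - {m}. \<bar>\<xi> m - \<xi> n\<bar> powr - \<sigma>) =
        (\<Sum>n\<in>?L. \<bar>\<xi> m - \<xi> n\<bar> powr - \<sigma>) + (\<Sum>n\<in>?R. \<bar>\<xi> m - \<xi> n\<bar> powr - \<sigma>)"
    by (subst sum.union_disjoint[symmetric]) (auto intro!: sum.cong)
  also have "\<dots> \<le> \<delta> powr - \<sigma> * Z + \<delta> powr - \<sigma> * Z"
    by (intro add_mono half) auto
  finally show ?thesis
    by (simp add: powr_minus_divide)
qed

text \<open>
  Schur's test: \<open>2 (a m \<bullet> a n) \<le> |a m|\<^sup>2 + |a n|\<^sup>2\<close> reduces the form to the row sums of its
  symmetric matrix.
\<close>

lemma upper_constant_series:
  assumes "0 < \<delta>" "0 < \<sigma>" and Z: "(\<lambda>k. real (Suc k) powr - \<sigma>) sums Z"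
  shows "upper_constant \<sigma> \<delta> (2 * Z / \<delta> powr \<sigma>)"
  unfolding upper_constant_def
proof (intro allI impI)
  fix N :: nat and \<xi> :: "nat \<Rightarrow> real" and a :: "nat \<Rightarrow> complex"
  assume sep: "separated \<delta> N \<xi>"
  define w where "w m n = (if n = m then 0 else \<bar>\<xi> m - \<xi> n\<bar> powr - \<sigma>)" for m n
  let ?S = "\<Sum>n\<in>{1..N}. (norm (a n))\<^sup>2"
  have w: "(\<Sum>n\<in>{1..N}. w m n * f n) = (\<Sum>n\<in>{1..N} - {m}. \<bar>\<xi> m - \<xi> n\<bar> powr - \<sigma> * f n)" for m f
    by (intro sum.mono_neutral_cong_right) (auto simp: w_def)
  have "w m n * (a m \<bullet> a n) \<le> w m n * ((norm (a m))\<^sup>2 / 2) + w m n * ((norm (a n))\<^sup>2 / 2)" for m n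
  proof -
    have "0 \<le> (norm (a m - a n))\<^sup>2" by simp
    then have "a m \<bullet> a n \<le> (norm (a m))\<^sup>2 / 2 + (norm (a n))\<^sup>2 / 2"
      by (simp add: power2_norm_eq_inner inner_diff_left inner_diff_right inner_commute)
    then have "w m n * (a m \<bullet> a n) \<le> w m n * ((norm (a m))\<^sup>2 / 2 + (norm (a n))\<^sup>2 / 2)"
      by (intro mult_left_mono) (auto simp: w_def)
    then show ?thesis by (simp add: distrib_left)
  qed
  then have "Re (hermitian_form \<sigma> N \<xi> a) \<le>
      (\<Sum>m\<in>{1..N}. \<Sum>n\<in>{1..N}. w m n * ((norm (a m))\<^sup>2 / 2) + w m n * ((norm (a n))\<^sup>2 / 2))"
    unfolding Re_hermitian_form w[symmetric] by (intro sum_mono)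
  also have "\<dots> = (\<Sum>m\<in>{1..N}. \<Sum>n\<in>{1..N}. w m n * ((norm (a m))\<^sup>2 / 2)) +
                  (\<Sum>m\<in>{1..N}. \<Sum>n\<in>{1..N}. w n m * ((norm (a m))\<^sup>2 / 2))"
    unfolding sum.distrib by (subst (3) sum.swap) simp
  also have "\<dots> = (\<Sum>m\<in>{1..N}. (\<Sum>n\<in>{1..N}. w m n * 1) * (norm (a m))\<^sup>2)"
    unfolding sum.distrib[symmetric] sum_distrib_right
    by (intro sum.cong refl) (auto simp: w_def abs_minus_commute)
  also have "\<dots> \<le> (\<Sum>m\<in>{1..N}. 2 * Z / \<delta> powr \<sigma> * (norm (a m))\<^sup>2)"
    unfolding w using separated_row_sum_bound[OF assms(1,2) sep _ Z]
    by (intro sum_mono mult_right_mono) auto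
  finally show "Re (hermitian_form \<sigma> N \<xi> a) \<le> 2 * Z / \<delta> powr \<sigma> * ?S"
    by (simp add: sum_distrib_left)
qed

section \<open>Sharpness on arithmetic progressions\<close>

text \<open>
  Passing from \<open>N\<close> to \<open>N + 1\<close> adds one row and one column, each with the entries
  \<open>f 1, \<dots>, f N\<close>. The form is therefore a sum of partial sums of a series, and its size per
  point is a Cesaro mean.
\<close>

lemma toeplitz_sum:
  fixes f :: "nat \<Rightarrow> real"
  shows "(\<Sum>m\<in>{1..N}. \<Sum>n\<in>{1..N} - {m}. f (nat \<bar>int m - int n\<bar>)) = 2 * (\<Sum>j<N. \<Sum>k<j. f (Suc k))"
proof (induction N)
  case (Suc N)
  let ?g = "\<lambda>m n. f (nat \<bar>int m - int n\<bar>)"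
  have row: "(\<Sum>n\<in>{1..Suc N} - {m}. ?g m n) = (\<Sum>n\<in>{1..N} - {m}. ?g m n) + ?g (Suc N) m"
    if "m \<in> {1..N}" for m
  proof -
    have "{1..Suc N} - {m} = insert (Suc N) ({1..N} - {m})" using that by auto
    then show ?thesis by (simp add: abs_minus_commute)
  qed
  have last: "(\<Sum>n\<in>{1..N}. ?g (Suc N) n) = (\<Sum>k<N. f (Suc k))"
    by (rule sum.reindex_bij_witness[of _ "\<lambda>k. N - k" "\<lambda>n. N - n"]) (auto intro!: arg_cong[of _ _ f])
  have "{1..Suc N} - {Suc N} = {1..N}" by auto
  then have "(\<Sum>m\<in>{1..Suc N}. \<Sum>n\<in>{1..Suc N} - {m}. ?g m n) =
        (\<Sum>m\<in>{1..N}. \<Sum>n\<in>{1..Suc N} - {m}. ?g m n) + (\<Sum>n\<in>{1..N}. ?g (Suc N) n)"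
    by simp
  also have "(\<Sum>m\<in>{1..N}. \<Sum>n\<in>{1..Suc N} - {m}. ?g m n) =
      (\<Sum>m\<in>{1..N}. \<Sum>n\<in>{1..N} - {m}. ?g m n) + (\<Sum>m\<in>{1..N}. ?g (Suc N) m)"
    using row by (simp add: sum.distrib)
  finally show ?case
    using Suc.IH last by simp
qed simp

lemma separated_progression: "0 < \<delta> \<Longrightarrow> separated \<delta> N (\<lambda>n. \<delta> * real n)"
proof -
  assume d: "0 < \<delta>"
  have "1 \<le> \<bar>real m - real n\<bar>" if "m \<noteq> n" for m n :: nat
    using that by linarith
  then show ?thesis
    using d by (auto simp: separated_def right_diff_distrib[symmetric] abs_mult)
qed

text \<open>
  These are the extremal configurations: \<open>\<epsilon> = -1\<close> for the lower and \<open>\<epsilon> = 1\<close> for the upper bound.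
\<close>

lemma hermitian_form_progression:
  fixes \<epsilon> :: real
  assumes "0 < \<delta>" "\<epsilon>\<^sup>2 = 1"
  shows "Re (hermitian_form \<sigma> N (\<lambda>n. \<delta> * real n) (\<lambda>n. of_real (\<epsilon> ^ n))) =
         2 * \<delta> powr - \<sigma> * (\<Sum>j<N. \<Sum>k<j. \<epsilon> ^ Suc k * real (Suc k) powr - \<sigma>)"
proof -
  have \<epsilon>: "\<epsilon> = 1 \<or> \<epsilon> = -1" using assms(2) by (simp add: power2_eq_1_iff)
  have "\<bar>\<delta> * real m - \<delta> * real n\<bar> powr - \<sigma> * (complex_of_real (\<epsilon> ^ m) \<bullet> of_real (\<epsilon> ^ n)) =
        \<delta> powr - \<sigma> * (\<epsilon> ^ nat \<bar>int m - int n\<bar> * real (nat \<bar>int m - int n\<bar>) powr - \<sigma>)" for m n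
  proof -
    have r: "\<bar>\<delta> * real m - \<delta> * real n\<bar> = \<delta> * real (nat \<bar>int m - int n\<bar>)"
      using assms(1) by (simp add: right_diff_distrib[symmetric] abs_mult)
    have "even (nat \<bar>int m - int n\<bar>) \<longleftrightarrow> even (m + n)"
      by (simp add: even_nat_iff)
    then have "\<epsilon> ^ m * \<epsilon> ^ n = \<epsilon> ^ nat \<bar>int m - int n\<bar>"
      using \<epsilon> by (auto simp: power_add[symmetric] minus_one_power_iff)
    then show ?thesis
      unfolding r using assms(1) by (simp add: powr_mult inner_complex_def)
  qed
  then show ?thesis
    unfolding Re_hermitian_form
    by (simp only: sum_distrib_left[symmetric]
          toeplitz_sum[of "\<lambda>k. \<epsilon> ^ k * real k powr - \<sigma>"] mult_ac)
qed

text \<open>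
  Sums of terms with limit \<open>l\<close> outgrow every linear bound with a slope below \<open>l\<close>.
\<close>

lemma average_bound_imp_limit_bound:
  fixes s :: "nat \<Rightarrow> real"
  assumes s: "s \<longlonglongrightarrow> l" and bound: "\<And>N. N \<ge> 1 \<Longrightarrow> (\<Sum>j<N. s j) \<le> c * real N"
  shows "l \<le> c"
proof (rule ccontr)
  assume "\<not> l \<le> c"
  define e where "e = (l - c) / 2"
  have e: "e > 0" using \<open>\<not> l \<le> c\<close> by (simp add: e_def)
  have "eventually (\<lambda>j. s j > c + e) sequentially"
    using e by (intro order_tendstoD(1)[OF s]) (simp add: e_def field_simps)
  then obtain M where M: "\<And>j. j \<ge> M \<Longrightarrow> s j > c + e"
    by (auto simp: eventually_sequentially)
  have lin: "(\<Sum>j<M. s j) + (c + e) * real k \<le> (\<Sum>j<M + k. s j)" for k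
  proof (induction k)
    case (Suc k)
    then show ?case using M[of "M + k"] by (simp add: algebra_simps)
  qed simp
  obtain k where k: "c * real M - (\<Sum>j<M. s j) < real k * e"
    using ex_less_of_nat_mult[OF e] by blast
  have "(\<Sum>j<M + k. s j) \<le> c * real (M + k)"
    using bound[of "M + k"] by (cases "M + k = 0") auto
  with lin[of k] k show False by (simp add: algebra_simps)
qed

lemma lower_constant_ge:
  assumes "0 < \<delta>" and C: "lower_constant \<sigma> \<delta> C"
    and L: "(\<lambda>k. (-1) ^ k * real (Suc k) powr - \<sigma>) sums L"
  shows "2 * L / \<delta> powr \<sigma> \<le> C"
proof -
  let ?s = "\<lambda>j. 2 * \<delta> powr - \<sigma> * (\<Sum>k<j. (-1) ^ k * real (Suc k) powr - \<sigma>)"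
  have "?s \<longlonglongrightarrow> 2 * \<delta> powr - \<sigma> * L"
    using L unfolding sums_def by (intro tendsto_intros)
  moreover have "(\<Sum>j<N. ?s j) \<le> C * real N" if "N \<ge> 1" for N
  proof -
    have "- C * (\<Sum>n\<in>{1..N}. (cmod (of_real ((-1) ^ n)))\<^sup>2) \<le>
          Re (hermitian_form \<sigma> N (\<lambda>n. \<delta> * real n) (\<lambda>n. of_real ((-1) ^ n)))"
      by (rule C[unfolded lower_constant_def, rule_format, OF that separated_progression[OF assms(1)]])
    also have "\<dots> = - (\<Sum>j<N. ?s j)"
      using assms(1) by (subst hermitian_form_progression) (auto simp: sum_distrib_left sum_negf)
    finally show ?thesis
      by (simp add: norm_power)
  qed
  ultimately have "2 * \<delta> powr - \<sigma> * L \<le> C"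
    by (rule average_bound_imp_limit_bound)
  then show ?thesis by (simp add: powr_minus_divide)
qed

lemma upper_constant_ge:
  assumes "0 < \<delta>" and C: "upper_constant \<sigma> \<delta> C"
    and Z: "(\<lambda>k. real (Suc k) powr - \<sigma>) sums Z"
  shows "2 * Z / \<delta> powr \<sigma> \<le> C"
proof -
  let ?s = "\<lambda>j. 2 * \<delta> powr - \<sigma> * (\<Sum>k<j. real (Suc k) powr - \<sigma>)"
  have "?s \<longlonglongrightarrow> 2 * \<delta> powr - \<sigma> * Z"
    using Z unfolding sums_def by (intro tendsto_intros)
  moreover have "(\<Sum>j<N. ?s j) \<le> C * real N" if "N \<ge> 1" for N
  proof -
    have "(\<Sum>j<N. ?s j) = Re (hermitian_form \<sigma> N (\<lambda>n. \<delta> * real n) (\<lambda>n. of_real (1 ^ n)))"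
      using assms(1) by (subst hermitian_form_progression) (auto simp: sum_distrib_left)
    also have "\<dots> \<le> C * (\<Sum>n\<in>{1..N}. (cmod (of_real (1 ^ n)))\<^sup>2)"
      by (rule C[unfolded upper_constant_def, rule_format, OF that separated_progression[OF assms(1)]])
    finally show ?thesis by simp
  qed
  ultimately have "2 * \<delta> powr - \<sigma> * Z \<le> C"
    by (rule average_bound_imp_limit_bound)
  then show ?thesis by (simp add: powr_minus_divide)
qed

lemma best_lower_constant_alternating_series:
  assumes "0 < \<delta>" "0 < \<sigma>" "(\<lambda>k. (-1) ^ k * real (Suc k) powr - \<sigma>) sums L"
  shows "best_lower_constant \<sigma> \<delta> (2 * L / \<delta> powr \<sigma>)"
  unfolding best_lower_constant_def
  using lower_constant_alternating_series[OF assms] lower_constant_ge assms by (meson not_le)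

lemma best_upper_constant_series:
  assumes "0 < \<delta>" "0 < \<sigma>" "(\<lambda>k. real (Suc k) powr - \<sigma>) sums Z"
  shows "best_upper_constant \<sigma> \<delta> (2 * Z / \<delta> powr \<sigma>)"
  unfolding best_upper_constant_def
  using upper_constant_series[OF assms] upper_constant_ge assms by (meson not_le)

section \<open>The best possible constants\<close>

theorem corollary22:
  fixes \<sigma> \<delta> :: real
  assumes "\<delta> > 0"
  shows "(0 < \<sigma> \<and> \<sigma> < 1 \<longrightarrow>
            best_lower_constant \<sigma> \<delta>
              ((2 - 2 powr (2 - \<sigma>)) * Re (zeta (of_real \<sigma>)) / \<delta> powr \<sigma>)) \<and>
         (\<sigma> = 1 \<longrightarrow> best_lower_constant \<sigma> \<delta> (ln 4 / \<delta>)) \<and>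
         (1 < \<sigma> \<longrightarrow>
            best_lower_constant \<sigma> \<delta>
              ((2 - 2 powr (2 - \<sigma>)) * Re (zeta (of_real \<sigma>)) / \<delta> powr \<sigma>) \<and>
            best_upper_constant \<sigma> \<delta> (2 * Re (zeta (of_real \<sigma>)) / \<delta> powr \<sigma>))"
proof -
  have lower: "best_lower_constant \<sigma> \<delta> ((2 - 2 powr (2 - \<sigma>)) * Re (zeta (of_real \<sigma>)) / \<delta> powr \<sigma>)"
    if "0 < \<sigma>" "\<sigma> \<noteq> 1"
  proof -
    have "2 powr (2 - \<sigma>) = 2 * 2 powr (1 - \<sigma>)"
      by (simp add: powr_diff)
    then have "(2 - 2 powr (2 - \<sigma>)) * Re (zeta (of_real \<sigma>)) =
               2 * ((1 - 2 powr (1 - \<sigma>)) * Re (zeta (of_real \<sigma>)))"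
      by (simp add: algebra_simps)
    then show ?thesis
      using best_lower_constant_alternating_series[OF assms that(1) alternating_powr_sums_zeta[OF that]]
      by (simp only:)
  qed
  moreover have "best_lower_constant \<sigma> \<delta> (ln 4 / \<delta>)" if "\<sigma> = 1"
  proof -
    have "ln 4 = 2 * ln (2::real)"
      using ln_realpow[of 2 2] by simp
    moreover have "(\<lambda>k. (-1) ^ k * real (Suc k) powr - \<sigma>) sums ln 2"
      using alternating_harmonic_series_sums that by (simp add: powr_minus_divide)
    ultimately show ?thesis
      using best_lower_constant_alternating_series[OF assms, of \<sigma> "ln 2"] that assms by simp
  qed
  moreover have "best_upper_constant \<sigma> \<delta> (2 * Re (zeta (of_real \<sigma>)) / \<delta> powr \<sigma>)" if "1 < \<sigma>"
    using best_upper_constant_series[OF assms _ powr_sums_zeta] that by simp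
  ultimately show ?thesis by auto
qed

end
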